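(* Let $\{f_\mu\}$, $\mu\in(a,b)$, be a monotonic family of PWL orientation preserving homeomorphisms of the circle, with corresponding family of lifts $\{F_\mu\}$. If there exists $\mu_c\in(a,b)$ such that $f_{\mu_c}$ is conjugate to a rigid rational rotation with rotation number $p/q$ (i.e. $\rho(F_{\mu_c})=p/q$), then $M_{p/q}=\{\mu_c\}$, where $M_{p/q}=\{\mu\in(a,b)\mid\rho(F_\mu)=p/q\}$.
   Context: The circle $\mathbb{S}^1=\mathbb{R}/\mathbb{Z}$ is parametrized by $x\in[0,1)$. An orientation preserving homeomorphism $f$ of the circle is described by a lift $F:\mathbb{R}\to\mathbb{R}$, continuous and strictly increasing with $F(x+1)=F(x)+1$ and $f(x)=F(x)\ (\mathrm{mod}\ 1)$; two lifts of $f$ differ by an integer. $f$ is piecewise linear (PWL) if there is a finite set of break points $0\le b_1<b_2<\dots<b_n<1$ such that $F$ is affine on each interval $(b_i,b_{i+1})$, $1\le i\le n-1$, and on $(b_n,b_1+1)$, and at each break point the left and right derivatives of $F$ differ. The rotation number of a lift is $\rho(F)=\lim_{m\to\infty}\frac1m(F^m(x)-x)$ (it exists and is independent of $x$). When considering families, rotation numbers are computed with the family of lifts. A rigid rational rotation is a map $r_\omega(x)=x+\omega\ (\mathrm{mod}\ 1)$ with $\omega$ rational. Maps $f,g$ of the circle are conjugate if there is a homeomorphism $h$ of the circle with $h\circ f=g\circ h$. A family $\{f_\mu\}$, $\mu\in(a,b)$, of orientation preserving circle homeomorphisms is continuous if there is a family of lifts $\{F_\mu\}$ such that $F_\mu(x)$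 is a continuous function of $\mu$ at fixed $x$ and continuous in $x$ at fixed $\mu$. The family is monotonic if it is continuous and $\mu_1<\mu_2$ implies $F_{\mu_1}(x)<F_{\mu_2}(x)$ for all $x\in\mathbb{R}$. *)

theory Defs
  imports "HOL-Analysis.Analysis"
begin

text \<open>
  The circle \<open>\<real>/\<int>\<close> is represented by its fundamental domain \<open>[0,1)\<close>, with \<^const>\<open>frac\<close>
  (reduction modulo 1) as the projection from \<open>\<real>\<close>. It carries the quotient topology, which is
  not the subspace topology of \<open>[0,1)\<close>; see \<open>quotient_map_frac\<close>. Circle maps are functions
  \<open>real \<Rightarrow> real\<close> of which only the values on \<open>[0,1)\<close> matter.
\<close>

definition circle :: "real topology" where
  "circle = topology (\<lambda>U. U \<subseteq> {0..<1} \<and> open (frac -` U))"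

lemma openin_circle: "openin circle U \<longleftrightarrow> U \<subseteq> {0..<1} \<and> open (frac -` U)"
proof -
  have "istopology (\<lambda>U::real set. U \<subseteq> {0..<1} \<and> open (frac -` U))"
    unfolding istopology_def by (auto simp: vimage_Union intro!: open_UN)
  then show ?thesis
    by (simp add: circle_def topology_inverse')
qed

lemma topspace_circle: "topspace circle = {0..<1}"
proof -
  have "frac -` {0..<1::real} = UNIV"
    by (auto simp: frac_lt_1)
  then have "openin circle {0..<1}"
    by (simp add: openin_circle)
  then show ?thesis
    by (metis openin_circle openin_subset openin_topspace subset_antisym)
qed

lemma quotient_map_frac: "quotient_map euclidean circle (frac :: real \<Rightarrow> real)"
proof -
  have "range frac = {0..<1::real}"
    by (auto simp: frac_lt_1 image_iff) (metis frac_eq)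
  then show ?thesis
    by (auto simp: quotient_map_def topspace_circle openin_circle vimage_def)
qed

definition is_lift :: "(real \<Rightarrow> real) \<Rightarrow> (real \<Rightarrow> real) \<Rightarrow> bool" where
  "is_lift F f \<longleftrightarrow>
     continuous_on UNIV F \<and> strict_mono F \<and> (\<forall>x. F (x + 1) = F x + 1) \<and>
     (\<forall>x\<in>{0..<1}. f x = frac (F x))"

definition orientation_preserving_homeo :: "(real \<Rightarrow> real) \<Rightarrow> bool" where
  "orientation_preserving_homeo f \<longleftrightarrow> homeomorphic_map circle circle f \<and> (\<exists>F. is_lift F f)"

definition affine_map_on :: "real set \<Rightarrow> (real \<Rightarrow> real) \<Rightarrow> bool" where
  "affine_map_on S F \<longleftrightarrow> (\<exists>c d. \<forall>x\<in>S. F x = c * x + d)"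

definition is_break_point :: "(real \<Rightarrow> real) \<Rightarrow> real \<Rightarrow> bool" where
  "is_break_point F x \<longleftrightarrow>
     (\<exists>l r. (F has_real_derivative l) (at_left x) \<and> (F has_real_derivative r) (at_right x) \<and> l \<noteq> r)"

text \<open>
  The list \<open>bs\<close> enumerates the break points in increasing order. Without break points there is
  no interval between break points to constrain \<open>F\<close>; that case is read as \<open>F\<close> being affine on
  all of \<open>\<real>\<close>, so that rigid rotations count as piecewise linear.
\<close>

definition pwl_lift :: "(real \<Rightarrow> real) \<Rightarrow> bool" where
  "pwl_lift F \<longleftrightarrow>
     (\<exists>bs. set bs \<subseteq> {0..<1} \<and> sorted_wrt (<) bs \<and>
       (\<forall>i. Suc i < length bs \<longrightarrow> affine_map_on {bs ! i<..<bs ! Suc i} F) \<and>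
       (if bs = [] then affine_map_on UNIV F else affine_map_on {last bs<..<hd bs + 1} F) \<and>
       (\<forall>x\<in>set bs. is_break_point F x))"

text \<open>Lifts of \<open>f\<close> differ by integers, so the choice of lift is immaterial here.\<close>

definition pwl_homeo :: "(real \<Rightarrow> real) \<Rightarrow> bool" where
  "pwl_homeo f \<longleftrightarrow> orientation_preserving_homeo f \<and> (\<exists>F. is_lift F f \<and> pwl_lift F)"

definition rotation_number :: "(real \<Rightarrow> real) \<Rightarrow> real" where
  "rotation_number F = (THE \<rho>. \<forall>x. (\<lambda>m. ((F ^^ m) x - x) / real m) \<longlonglongrightarrow> \<rho>)"

definition rigid_rotation :: "real \<Rightarrow> real \<Rightarrow> real" where
  "rigid_rotation \<omega> x = frac (x + \<omega>)"

definition circle_conjugate :: "(real \<Rightarrow> real) \<Rightarrow> (real \<Rightarrow> real) \<Rightarrow> bool" where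
  "circle_conjugate f g \<longleftrightarrow>
     (\<exists>h. homeomorphic_map circle circle h \<and> (\<forall>x\<in>topspace circle. h (f x) = g (h x)))"

text \<open>The family \<open>F\<close> of lifts is a parameter, since rotation numbers depend on it.\<close>

definition continuous_family ::
    "real \<Rightarrow> real \<Rightarrow> (real \<Rightarrow> real \<Rightarrow> real) \<Rightarrow> (real \<Rightarrow> real \<Rightarrow> real) \<Rightarrow> bool" where
  "continuous_family a b f F \<longleftrightarrow>
     (\<forall>\<mu>\<in>{a<..<b}. orientation_preserving_homeo (f \<mu>) \<and> is_lift (F \<mu>) (f \<mu>)) \<and>
     (\<forall>x. continuous_on {a<..<b} (\<lambda>\<mu>. F \<mu> x)) \<and>
     (\<forall>\<mu>\<in>{a<..<b}. continuous_on UNIV (F \<mu>))"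

definition monotonic_family ::
    "real \<Rightarrow> real \<Rightarrow> (real \<Rightarrow> real \<Rightarrow> real) \<Rightarrow> (real \<Rightarrow> real \<Rightarrow> real) \<Rightarrow> bool" where
  "monotonic_family a b f F \<longleftrightarrow>
     continuous_family a b f F \<and>
     (\<forall>\<mu>\<^sub>1\<in>{a<..<b}. \<forall>\<mu>\<^sub>2\<in>{a<..<b}. \<mu>\<^sub>1 < \<mu>\<^sub>2 \<longrightarrow> (\<forall>x. F \<mu>\<^sub>1 x < F \<mu>\<^sub>2 x))"

definition rotation_level_set :: "real \<Rightarrow> real \<Rightarrow> (real \<Rightarrow> real \<Rightarrow> real) \<Rightarrow> real \<Rightarrow> real set" where
  "rotation_level_set a b F \<rho> = {\<mu> \<in> {a<..<b}. rotation_number (F \<mu>) = \<rho>}"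

end

theory Submission
  imports Defs
begin

text \<open>
  Conjugacy to a rational rotation forces some iterate \<open>f\<^bsub>\<mu>\<^sub>c\<^esub>\<^sup>n\<close> to be the identity of the
  circle, so the \<open>n\<close>-th iterate of the lift \<open>G = F \<mu>\<^sub>c\<close> is exactly a translation
  \<open>x \<mapsto> x + k\<close> by an integer (\<open>conjugate_to_rational_imp_translation\<close>), and the rotation number
  of \<open>G\<close> is \<open>k / n\<close>. For \<open>\<mu> > \<mu>\<^sub>c\<close> monotonicity of the family
  gives \<open>(F \<mu>)\<^sup>n x > x + k\<close> for every \<open>x\<close>. The displacement \<open>(F \<mu>)\<^sup>n x - x\<close> is continuous and
  1-periodic, so it attains its minimum, which is some \<open>d > k\<close>; along the iterates the orbit then
  gains at least \<open>d\<close> every \<open>n\<close> steps, and the rotation number is at least \<open>d / n > k / n\<close>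
  (\<open>rotation_number_greater\<close>). The case \<open>\<mu> < \<mu>\<^sub>c\<close> is symmetric.

  The comparison of orbit averages with \<open>rotation_number\<close> rests on Poincare's theorem that the
  defining limit exists and does not depend on the base point (\<open>rotation_number_tendsto\<close>).
  It follows from the fact that the displacements of a monotone degree one map at any two points
  differ by at most 1, which makes the displacement of the \<open>m\<close>-th iterate almost additive in \<open>m\<close>.
\<close>

section \<open>Almost additive sequences\<close>

text \<open>
  Summing the defect over \<open>l\<close> blocks of length \<open>m\<close> gives \<open>\<bar>a (l * m) - l * a m\<bar> \<le> C * (l + 1)\<close>. Comparing both
  \<open>a m / m\<close> and \<open>a l / l\<close> with \<open>a (l * m) / (l * m)\<close> then shows that the averages form a Cauchy sequence.
\<close>

lemma almost_additive_averages_convergent: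
  fixes a :: "nat \<Rightarrow> real"
  assumes additive: "\<And>m l. \<bar>a (m + l) - a m - a l\<bar> \<le> C"
  shows "convergent (\<lambda>m. a m / real m)"
proof -
  have C: "C \<ge> 0"
    using additive[of 0 0] by linarith
  have block: "\<bar>a (l * m) - real l * a m\<bar> \<le> C * real l + C" for l m
  proof (induction l)
    case 0
    show ?case using additive[of 0 0] by simp
  next
    case (Suc l)
    show ?case using additive[of m "l * m"] Suc by (simp add: algebra_simps abs_le_iff)
  qed
  have avg: "\<bar>a (l * m) / real (l * m) - a m / real m\<bar> \<le> 2 * C / real m"
    if "l > 0" "m > 0" for l m
  proof -
    have "\<bar>a (l * m) / real (l * m) - a m / real m\<bar> = \<bar>a (l * m) - real l * a m\<bar> / real (l * m)"
    proof -
      have "a (l * m) / real (l * m) - a m / real m = (a (l * m) - real l * a m) / real (l * m)"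
        using that by (simp add: field_simps)
      then show ?thesis by simp
    qed
    also have "\<dots> \<le> (2 * C * real l) / real (l * m)"
    proof (rule divide_right_mono)
      have "C * 1 \<le> C * real l"
        using C that by (intro mult_left_mono) auto
      then show "\<bar>a (l * m) - real l * a m\<bar> \<le> 2 * C * real l"
        using block[of l m] by simp
    qed simp
    also have "\<dots> = 2 * C / real m"
      using that by simp
    finally show ?thesis .
  qed
  have "Cauchy (\<lambda>m. a m / real m)"
  proof (rule metric_CauchyI)
    fix e :: real
    assume "e > 0"
    obtain N :: nat where N: "4 * C / e < real N"
      using reals_Archimedean2 by blast
    have "dist (a m / real m) (a l / real l) < e" if "m \<ge> Suc N" "l \<ge> Suc N" for m l
    proof -
      have small: "2 * C / real j < e / 2" if "j \<ge> Suc N" for j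
      proof -
        have "4 * C / e < real j" using N that by linarith
        then show ?thesis using \<open>e > 0\<close> that by (simp add: field_simps)
      qed
      show ?thesis
        using avg[of l m] avg[of m l] small[OF that(1)] small[OF that(2)] that
        unfolding dist_real_def by (simp add: mult.commute[of m l])
    qed
    then show "\<exists>M. \<forall>m\<ge>M. \<forall>n\<ge>M. dist (a m / real m) (a n / real n) < e"
      by blast
  qed
  then show ?thesis
    by (simp add: Cauchy_convergent_iff)
qed

section \<open>Monotone maps of degree one and their rotation numbers\<close>

locale monotone_degree_one =
  fixes F :: "real \<Rightarrow> real"
  assumes mono: "mono F"
    and shift_one: "F (x + 1) = F x + 1"
begin

lemma shift_int: "F (x + of_int k) = F x + of_int k"
proof (induction k rule: int_induct[where k = 0])
  case base
  show ?case by simp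
next
  case (step1 i)
  then show ?case using shift_one[of "x + of_int i"] by (simp add: algebra_simps)
next
  case (step2 i)
  then show ?case using shift_one[of "x + of_int (i - 1)"] by (simp add: algebra_simps)
qed

text \<open>
  If \<open>y\<close> lies in \<open>[x + j, x + j + 1)\<close> for an integer \<open>j\<close>, then monotonicity confines \<open>F y\<close> to
  \<open>[F x + j, F x + j + 1]\<close>, so \<open>y - x\<close> and \<open>F y - F x\<close> lie in a common interval of length 1.
\<close>

lemma displacement_oscillation: "\<bar>(F y - y) - (F x - x)\<bar> \<le> 1"
proof -
  define j where "j = \<lfloor>y - x\<rfloor>"
  have j: "x + of_int j \<le> y" "y \<le> x + of_int (j + 1)"
    unfolding j_def by linarith+
  then have "F x + of_int j \<le> F y" "F y \<le> F x + of_int (j + 1)"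
    using monoD[OF mono] by (metis shift_int)+
  with j show ?thesis by (simp add: abs_le_iff)
qed

lemma monotone_degree_one_funpow: "monotone_degree_one (F ^^ n)"
proof
  show "mono (F ^^ n)"
    using mono by (rule mono_pow)
  show "(F ^^ n) (x + 1) = (F ^^ n) x + 1" for x
    by (induction n) (auto simp: shift_one)
qed

theorem rotation_number_tendsto:
  "(\<lambda>m. ((F ^^ m) x - x) / real m) \<longlonglongrightarrow> rotation_number F"
proof -
  have osc: "\<bar>((F ^^ m) y - y) - ((F ^^ m) x - x)\<bar> \<le> 1" for m x y
    using monotone_degree_one.displacement_oscillation[OF monotone_degree_one_funpow] .
  have "convergent (\<lambda>m. ((F ^^ m) 0 - 0) / real m)"
  proof (rule almost_additive_averages_convergent)
    show "\<bar>((F ^^ (m + l)) 0 - 0) - ((F ^^ m) 0 - 0) - ((F ^^ l) 0 - 0)\<bar> \<le> 1" for m l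
      using osc[of m "(F ^^ l) 0" 0] by (simp add: funpow_add abs_le_iff)
  qed
  then obtain \<rho> where \<rho>: "(\<lambda>m. ((F ^^ m) 0 - 0) / real m) \<longlonglongrightarrow> \<rho>"
    by (auto simp: convergent_def)
  have lim: "(\<lambda>m. ((F ^^ m) x - x) / real m) \<longlonglongrightarrow> \<rho>" for x
  proof (rule Lim_transform[OF \<rho>])
    show "(\<lambda>m. ((F ^^ m) x - x) / real m - ((F ^^ m) 0 - 0) / real m) \<longlonglongrightarrow> 0"
    proof (rule Lim_null_comparison)
      show "\<forall>\<^sub>F m in sequentially.
          norm (((F ^^ m) x - x) / real m - ((F ^^ m) 0 - 0) / real m) \<le> 1 / real m"
        using osc[of _ x 0] by (auto intro!: always_eventually divide_right_mono
            simp flip: diff_divide_distrib)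
      show "(\<lambda>m. 1 / real m) \<longlonglongrightarrow> 0"
        by (rule lim_1_over_n)
    qed
  qed
  have "rotation_number F = \<rho>"
    unfolding rotation_number_def
    by (rule the_equality) (use lim LIMSEQ_unique in blast)+
  with lim show ?thesis by simp
qed

text \<open>Since the full limit exists, it can be computed along the multiples of a period \<open>n\<close>.\<close>

lemma rotation_number_subsequence:
  assumes "n > 0"
  shows "(\<lambda>j. ((F ^^ (n * j)) x - x) / real (n * j)) \<longlonglongrightarrow> rotation_number F"
proof -
  have "strict_mono (\<lambda>j. n * j)"
    using assms by (auto simp: strict_mono_def)
  from LIMSEQ_subseq_LIMSEQ[OF rotation_number_tendsto[of x] this]
  show ?thesis by (simp add: o_def)
qed

lemma rotation_number_ge:
  assumes "n > 0" and gain: "\<And>x. x + d \<le> (F ^^ n) x"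
  shows "d / real n \<le> rotation_number F"
proof (rule LIMSEQ_le_const[OF rotation_number_subsequence[OF assms(1), of 0]])
  have orbit: "real j * d \<le> (F ^^ (n * j)) 0" for j
  proof (induction j)
    case (Suc j)
    then show ?case
      using gain[of "(F ^^ (n * j)) 0"] by (simp add: funpow_add algebra_simps)
  qed simp
  have "d / real n \<le> ((F ^^ (n * j)) 0 - 0) / real (n * j)" if "j \<ge> 1" for j
    using orbit[of j] that assms(1) by (simp add: field_simps)
  then show "\<exists>N. \<forall>j\<ge>N. d / real n \<le> ((F ^^ (n * j)) 0 - 0) / real (n * j)"
    by blast
qed

lemma rotation_number_le:
  assumes "n > 0" and gain: "\<And>x. (F ^^ n) x \<le> x + d"
  shows "rotation_number F \<le> d / real n"
proof (rule LIMSEQ_le_const2[OF rotation_number_subsequence[OF assms(1), of 0]])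
  have orbit: "(F ^^ (n * j)) 0 \<le> real j * d" for j
  proof (induction j)
    case (Suc j)
    then show ?case
      using gain[of "(F ^^ (n * j)) 0"] by (simp add: funpow_add algebra_simps)
  qed simp
  have "((F ^^ (n * j)) 0 - 0) / real (n * j) \<le> d / real n" if "j \<ge> 1" for j
    using orbit[of j] that assms(1) by (simp add: field_simps)
  then show "\<exists>N. \<forall>j\<ge>N. ((F ^^ (n * j)) 0 - 0) / real (n * j) \<le> d / real n"
    by blast
qed

lemma displacement_frac: "F (frac x) - frac x = F x - x"
  using shift_int[of "frac x" "\<lfloor>x\<rfloor>"] by (simp add: frac_def)

end

section \<open>Strict bounds from compactness of the circle\<close>

locale continuous_degree_one = monotone_degree_one +
  assumes continuous: "continuous_on UNIV F"
begin

lemma continuous_on_funpow: "continuous_on UNIV (F ^^ n)"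
proof (induction n)
  case (Suc n)
  then show ?case
    using continuous_on_compose[OF Suc continuous_on_subset[OF continuous]] by simp
qed (simp add: id_def)

text \<open>
  The displacement of an iterate is determined by its values on the compact interval \<open>[0,1]\<close>, so
  it attains its bounds. This is what turns a pointwise strict inequality into a uniform gap,
  and hence into a strict inequality that survives the limit.
\<close>

lemma rotation_number_greater:
  assumes "n > 0" and gain: "\<And>x. x + c < (F ^^ n) x"
  shows "c / real n < rotation_number F"
proof -
  interpret iter: monotone_degree_one "F ^^ n"
    by (rule monotone_degree_one_funpow)
  have "\<exists>x\<in>{0..1::real}. \<forall>y\<in>{0..1}. (F ^^ n) x - x \<le> (F ^^ n) y - y"
    by (rule continuous_attains_inf)
      (auto intro!: continuous_intros continuous_on_subset[OF continuous_on_funpow])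
  then obtain x where min: "\<forall>y\<in>{0..1}. (F ^^ n) x - x \<le> (F ^^ n) y - y"
    by blast
  have "y + ((F ^^ n) x - x) \<le> (F ^^ n) y" for y
    using min[rule_format, of "frac y"] iter.displacement_frac[of y]
    by (simp add: frac_lt_1 less_imp_le)
  then have "((F ^^ n) x - x) / real n \<le> rotation_number F"
    by (rule rotation_number_ge[OF assms(1)])
  moreover have "c / real n < ((F ^^ n) x - x) / real n"
    using gain[of x] assms(1) by (intro divide_strict_right_mono) auto
  ultimately show ?thesis by simp
qed

lemma rotation_number_less:
  assumes "n > 0" and gain: "\<And>x. (F ^^ n) x < x + c"
  shows "rotation_number F < c / real n"
proof -
  interpret iter: monotone_degree_one "F ^^ n"
    by (rule monotone_degree_one_funpow)
  have "\<exists>x\<in>{0..1::real}. \<forall>y\<in>{0..1}. (F ^^ n) y - y \<le> (F ^^ n) x - x"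
    by (rule continuous_attains_sup)
      (auto intro!: continuous_intros continuous_on_subset[OF continuous_on_funpow])
  then obtain x where max: "\<forall>y\<in>{0..1}. (F ^^ n) y - y \<le> (F ^^ n) x - x"
    by blast
  have "(F ^^ n) y \<le> y + ((F ^^ n) x - x)" for y
    using max[rule_format, of "frac y"] iter.displacement_frac[of y]
    by (simp add: frac_lt_1 less_imp_le)
  then have "rotation_number F \<le> ((F ^^ n) x - x) / real n"
    by (rule rotation_number_le[OF assms(1)])
  moreover have "((F ^^ n) x - x) / real n < c / real n"
    using gain[of x] assms(1) by (intro divide_strict_right_mono) auto
  ultimately show ?thesis by simp
qed

end

lemma is_lift_imp_continuous_degree_one:
  assumes "is_lift F f"
  shows "continuous_degree_one F"
  using assms by unfold_locales (auto simp: is_lift_def strict_mono_mono)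

lemma funpow_strict_less:
  fixes F G :: "real \<Rightarrow> real"
  assumes "mono F" and less: "\<And>x. F x < G x" and "n > 0"
  shows "(F ^^ n) x < (G ^^ n) x"
  using assms(3)
proof (induction n)
  case (Suc n)
  have "(F ^^ n) x \<le> (G ^^ n) x"
    using Suc by (cases "n = 0") auto
  then have "F ((F ^^ n) x) \<le> F ((G ^^ n) x)"
    by (rule monoD[OF assms(1)])
  also have "\<dots> < G ((G ^^ n) x)"
    by (rule less)
  finally show ?case by simp
qed simp

section \<open>Conjugacy to a rational rotation\<close>

lemma is_lift_funpow_frac:
  assumes "is_lift F f"
  shows "(f ^^ n) (frac x) = frac ((F ^^ n) x)"
proof (induction n)
  case (Suc n)
  interpret continuous_degree_one F
    using assms by (rule is_lift_imp_continuous_degree_one)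
  let ?y = "(F ^^ n) x"
  have "F ?y = F (frac ?y) + of_int \<lfloor>?y\<rfloor>"
    using displacement_frac[of ?y] by (simp add: frac_def)
  then have "frac (F ?y) = frac (F (frac ?y))"
    by simp
  also have "\<dots> = f (frac ?y)"
    using assms by (simp add: is_lift_def frac_lt_1)
  finally show ?case
    using Suc by simp
qed simp

text \<open>
  If \<open>n \<omega>\<close> is an integer, the \<open>n\<close>-th iterate of the rotation is the identity, and so is that of any
  conjugate map \<open>f\<close>. For a lift \<open>F\<close> this says that \<open>F\<^sup>n x - x\<close> is an integer for every \<open>x\<close>; being
  continuous, it is one and the same integer for all \<open>x\<close>.
\<close>

lemma conjugate_to_rational_imp_translation:
  assumes lift: "is_lift F f" and conj: "circle_conjugate f (rigid_rotation \<omega>)"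
    and "\<omega> \<in> \<rat>"
  obtains n :: nat and k :: int where "n > 0" and "\<And>x. (F ^^ n) x = x + of_int k"
proof -
  interpret continuous_degree_one F
    using lift by (rule is_lift_imp_continuous_degree_one)
  obtain m n :: int where "n > 0" and \<omega>: "\<omega> = of_int m / of_int n"
    using \<open>\<omega> \<in> \<rat>\<close> by (metis Rats_cases')
  define N where "N = nat n"
  have N: "N > 0" "real N * \<omega> = of_int m"
    using \<open>n > 0\<close> \<omega> by (simp_all add: N_def)
  obtain h where h: "homeomorphic_map circle circle h"
    and hf: "\<And>x. x \<in> {0..<1} \<Longrightarrow> h (f x) = rigid_rotation \<omega> (h x)"
    using conj by (auto simp: circle_conjugate_def topspace_circle)
  have h_inj: "inj_on h {0..<1}"
    using homeomorphic_imp_injective_map[OF h] by (simp add: topspace_circle)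
  have h_circle: "h x \<in> {0..<1}" if "x \<in> {0..<1}" for x
    using homeomorphic_imp_surjective_map[OF h] that by (auto simp: topspace_circle)
  have orbit_circle: "(f ^^ j) x \<in> {0..<1}" if "x \<in> {0..<1}" for j x
    using is_lift_funpow_frac[OF lift, of j x] that by (auto simp: frac_lt_1 frac_eq)
  have orbit: "h ((f ^^ j) x) = frac (h x + real j * \<omega>)" if x: "x \<in> {0..<1}" for j x
  proof (induction j)
    case 0
    show ?case using h_circle[OF x] by (simp add: frac_eq)
  next
    case (Suc j)
    have "h ((f ^^ Suc j) x) = frac (frac (h x + real j * \<omega>) + \<omega>)"
      using hf[OF orbit_circle[OF x, of j]] Suc by (simp add: rigid_rotation_def)
    also have "\<dots> = frac (h x + real j * \<omega> + \<omega>)"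
      by simp
    finally show ?case by (simp add: algebra_simps)
  qed
  have periodic: "(f ^^ N) x = x" if x: "x \<in> {0..<1}" for x
  proof -
    have "h ((f ^^ N) x) = h x"
      using orbit[OF x, of N] N h_circle[OF x] by (simp add: frac_eq)
    then show ?thesis
      using h_inj orbit_circle[OF x] x by (auto dest: inj_onD)
  qed
  define D where "D x = (F ^^ N) x - x" for x
  have D_int: "D x \<in> \<int>" for x
  proof -
    have "frac ((F ^^ N) x) = frac x"
      using is_lift_funpow_frac[OF lift, of N x] periodic[of "frac x"] by (simp add: frac_lt_1)
    then have "D x = of_int (\<lfloor>(F ^^ N) x\<rfloor> - \<lfloor>x\<rfloor>)"
      by (simp add: D_def frac_def)
    then show ?thesis by simp
  qed
  have "D constant_on UNIV"
  proof (rule continuous_discrete_range_constant)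
    show "continuous_on UNIV D"
      unfolding D_def by (intro continuous_intros continuous_on_funpow)
    show "\<exists>e>0. \<forall>y. y \<in> UNIV \<and> D y \<noteq> D x \<longrightarrow> e \<le> norm (D y - D x)" for x
      using D_int Ints_nonzero_abs_ge1[of "D y - D x" for y]
      by (intro exI[of _ 1]) auto
  qed simp
  then obtain k where "\<And>x. D x = of_int k"
    using D_int[of 0] by (auto simp: constant_on_def elim!: Ints_cases)
  then have "(F ^^ N) x = x + of_int k" for x
    by (simp add: D_def algebra_simps)
  with N(1) show thesis by (rule that)
qed

section \<open>Isolation of the parameter\<close>

theorem theorem2p5:
  fixes a b \<mu>\<^sub>c \<omega> :: real
    and f F :: "real \<Rightarrow> real \<Rightarrow> real"
    and p :: int and q :: nat
  assumes "monotonic_family a b f F"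
    and "\<And>\<mu>. \<mu> \<in> {a<..<b} \<Longrightarrow> pwl_homeo (f \<mu>)"
    and "\<mu>\<^sub>c \<in> {a<..<b}"
    and "q > 0"
    and "\<omega> \<in> \<rat>"
    and "circle_conjugate (f \<mu>\<^sub>c) (rigid_rotation \<omega>)"
    and "rotation_number (F \<mu>\<^sub>c) = of_int p / of_nat q"
  shows "rotation_level_set a b F (of_int p / of_nat q) = {\<mu>\<^sub>c}"
proof -
  have lift: "is_lift (F \<mu>) (f \<mu>)" if "\<mu> \<in> {a<..<b}" for \<mu>
    using assms(1) that by (auto simp: monotonic_family_def continuous_family_def)
  have less: "F \<mu> x < F \<nu> x" if "\<mu> \<in> {a<..<b}" "\<nu> \<in> {a<..<b}" "\<mu> < \<nu>" for \<mu> \<nu> x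
    using assms(1) that by (auto simp: monotonic_family_def)
  obtain n k where n: "n > 0" and trans: "\<And>x. (F \<mu>\<^sub>c ^^ n) x = x + of_int k"
    using conjugate_to_rational_imp_translation[OF lift[OF assms(3)] assms(6) assms(5)]
    by blast
  interpret c: continuous_degree_one "F \<mu>\<^sub>c"
    using lift[OF assms(3)] by (rule is_lift_imp_continuous_degree_one)
  have rot_c: "rotation_number (F \<mu>\<^sub>c) = of_int k / real n"
    using c.rotation_number_ge[OF n, of "of_int k"] c.rotation_number_le[OF n, of "of_int k"] trans
    by simp
  have "rotation_number (F \<mu>) \<noteq> rotation_number (F \<mu>\<^sub>c)" if \<mu>: "\<mu> \<in> {a<..<b}" "\<mu> \<noteq> \<mu>\<^sub>c" for \<mu>
  proof -
    interpret m: continuous_degree_one "F \<mu>"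
      using lift[OF \<mu>(1)] by (rule is_lift_imp_continuous_degree_one)
    show ?thesis
    proof (cases "\<mu>\<^sub>c < \<mu>")
      case True
      have "x + of_int k < (F \<mu> ^^ n) x" for x
        using funpow_strict_less[OF c.mono less[OF assms(3) \<mu>(1) True] n, of x] trans by simp
      from m.rotation_number_greater[OF n this] show ?thesis
        by (simp add: rot_c)
    next
      case False
      with \<mu>(2) have "\<mu> < \<mu>\<^sub>c" by simp
      have "(F \<mu> ^^ n) x < x + of_int k" for x
        using funpow_strict_less[OF m.mono less[OF \<mu>(1) assms(3) \<open>\<mu> < \<mu>\<^sub>c\<close>] n, of x] trans
        by simp
      from m.rotation_number_less[OF n this] show ?thesis
        by (simp add: rot_c)
    qed
  qed
  then show ?thesis
    using assms(3,7) by (auto simp: rotation_level_set_def)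
qed

end
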